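(* Let $r\in\mathbb{Q}\cap\,]0,+\infty[$. There exists a partial group $\mathcal{M}$, with finite underlying set, such that $$r=\frac{|\mathrm{Aut}(\mathcal{M})|}{|\mathcal{M}|},$$ where $\mathrm{Aut}(\mathcal{M})$ is the group of automorphisms of $\mathcal{M}$ in the category of partial groups and $|\mathcal{M}|$ is the number of elements of the underlying set of $\mathcal{M}$.
   Context: For a set $X$, $\mathbb{W}(X)$ denotes the free monoid of finite words on $X$ (including the empty word $\emptyset$), $u\circ v$ denotes concatenation, and $X$ is identified with the set of words of length 1. A map $\varphi\colon X\to Y$ induces $\mathbb{W}(\varphi)\colon\mathbb{W}(X)\to\mathbb{W}(Y)$ letterwise. A partial group is a tuple $(\mathcal{M},\mathbb{D},\Pi,(-)^{-1})$ where $\mathcal{M}$ is a set, $\mathbb{D}\subseteq\mathbb{W}(\mathcal{M})$, $\Pi\colon\mathbb{D}\to\mathcal{M}$ is a map, and $(-)^{-1}\colon\mathcal{M}\to\mathcal{M}$ is an involutory bijection, extended to $\mathbb{W}(\mathcal{M})$ by $(x_1,\dots,x_n)^{-1}=(x_n^{-1},\dots,x_1^{-1})$, such that: (D1) $\mathcal{M}\subseteq\mathbb{D}$; (D2) if $u\circ v\in\mathbb{D}$ then $u,v\in\mathbb{D}$ (in particular $\emptyset\in\mathbb{D}$); (P1) $\Pi$ restricts to the identity on $\mathcal{M}$; (P2) if $u\circ v\circ w\in\mathbb{D}$ then $u\circ\Pi(v)\circ w\in\mathbb{D}$ and $\Pi(u\circ v\circ w)=\Pi(u\circ\Pi(v)\circ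 w)$; (P3) if $u\in\mathbb{D}$ then $u^{-1}\circ u\in\mathbb{D}$ and $\Pi(u^{-1}\circ u)=1$, where $1:=\Pi(\emptyset)$. A homomorphism of partial groups from $(\mathcal{M}_1,\mathbb{D}_1,\Pi_1,(-)^{-1})$ to $(\mathcal{M}_2,\mathbb{D}_2,\Pi_2,(-)^{-1})$ is a map $\varphi\colon\mathcal{M}_1\to\mathcal{M}_2$ such that $\mathbb{W}(\varphi)(\mathbb{D}_1)\subseteq\mathbb{D}_2$ and $\Pi_2(\mathbb{W}(\varphi)(u))=\varphi(\Pi_1(u))$ for all $u\in\mathbb{D}_1$. Partial groups with these homomorphisms and composition of maps form a category. *)

theory Defs
  imports Complex_Main "HOL-Algebra.Coset"
begin

text \<open>
  The free monoid of words on a set \<open>X\<close> is \<open>lists X\<close>, concatenation is \<open>(@)\<close>, the letterwise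
  extension of a map \<open>\<phi>\<close> is \<open>map \<phi>\<close>, and a letter \<open>x\<close> is identified with the word \<open>[x]\<close>.
\<close>

record 'a pgroup = "'a partial_object" +
  words :: "'a list set"
  product :: "'a list \<Rightarrow> 'a"
  pinv :: "'a \<Rightarrow> 'a"

definition word_inv :: "('a, 'b) pgroup_scheme \<Rightarrow> 'a list \<Rightarrow> 'a list" where
  "word_inv M u = rev (map (pinv M) u)"

text \<open>
  The maps \<open>product M\<close> and \<open>pinv M\<close> are constrained only on \<open>words M\<close> and \<open>carrier M\<close>; their values
  elsewhere are irrelevant. The axiom \<open>Nil_in_words\<close> follows from \<open>D1\<close> and \<open>D2\<close> when the carrier is
  nonempty. Stating it separately makes the unit \<open>product M []\<close> meaningful in all cases, and it
  excludes the empty carrier.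
\<close>

locale partial_group =
  fixes M :: "('a, 'b) pgroup_scheme"
  assumes words_subset: "words M \<subseteq> lists (carrier M)"
    and product_closed: "product M \<in> words M \<rightarrow> carrier M"
    and pinv_closed: "pinv M \<in> carrier M \<rightarrow> carrier M"
    and pinv_pinv: "x \<in> carrier M \<Longrightarrow> pinv M (pinv M x) = x"
    and D1: "x \<in> carrier M \<Longrightarrow> [x] \<in> words M"
    and D2: "u @ v \<in> words M \<Longrightarrow> u \<in> words M \<and> v \<in> words M"
    and Nil_in_words: "[] \<in> words M"
    and P1: "x \<in> carrier M \<Longrightarrow> product M [x] = x"
    and P2: "u @ v @ w \<in> words M \<Longrightarrow>
      u @ [product M v] @ w \<in> words M \<and> product M (u @ v @ w) = product M (u @ [product M v] @ w)"
    and P3: "u \<in> words M \<Longrightarrow>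
      word_inv M u @ u \<in> words M \<and> product M (word_inv M u @ u) = product M []"

text \<open>
  Morphisms are extensional functions (equal to \<open>undefined\<close> outside the carrier), so that each map
  between the underlying sets is represented by exactly one HOL function and counting is meaningful.
\<close>

definition pgroup_hom ::
    "('a, 'c) pgroup_scheme \<Rightarrow> ('b, 'd) pgroup_scheme \<Rightarrow> ('a \<Rightarrow> 'b) set" where
  "pgroup_hom M N = {\<phi> \<in> carrier M \<rightarrow>\<^sub>E carrier N.
     \<forall>u \<in> words M. map \<phi> u \<in> words N \<and> product N (map \<phi> u) = \<phi> (product M u)}"

definition pgroup_id :: "('a, 'b) pgroup_scheme \<Rightarrow> 'a \<Rightarrow> 'a" where
  "pgroup_id M = (\<lambda>x \<in> carrier M. x)"

definition pgroup_auts :: "('a, 'b) pgroup_scheme \<Rightarrow> ('a \<Rightarrow> 'a) set" where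
  "pgroup_auts M = {\<phi> \<in> pgroup_hom M M. \<exists>\<psi> \<in> pgroup_hom M M.
     compose (carrier M) \<psi> \<phi> = pgroup_id M \<and> compose (carrier M) \<phi> \<psi> = pgroup_id M}"

definition pgroup_Aut :: "('a, 'b) pgroup_scheme \<Rightarrow> ('a \<Rightarrow> 'a) monoid" where
  "pgroup_Aut M =
     \<lparr>carrier = pgroup_auts M, monoid.mult = compose (carrier M), one = pgroup_id M\<rparr>"

lemma pgroup_hom_compose:
  assumes M: "partial_group M" and f: "\<phi> \<in> pgroup_hom M N" and g: "\<psi> \<in> pgroup_hom N P"
  shows "compose (carrier M) \<psi> \<phi> \<in> pgroup_hom M P"
proof -
  have "map (compose (carrier M) \<psi> \<phi>) u = map \<psi> (map \<phi> u)"
    and "product M u \<in> carrier M" if "u \<in> words M" for u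
    using that partial_group.words_subset[OF M] partial_group.product_closed[OF M]
    by (auto simp: compose_def)
  moreover have "compose (carrier M) \<psi> \<phi> \<in> carrier M \<rightarrow>\<^sub>E carrier P"
    using f g by (auto simp: pgroup_hom_def compose_def)
  ultimately show ?thesis
    using f g by (simp add: pgroup_hom_def compose_eq del: map_map map_eq_conv)
qed

lemma pgroup_id_hom:
  assumes M: "partial_group M"
  shows "pgroup_id M \<in> pgroup_hom M M"
proof -
  have "map (pgroup_id M) u = u" and "product M u \<in> carrier M" if "u \<in> words M" for u
    using that partial_group.words_subset[OF M] partial_group.product_closed[OF M]
    by (auto simp: pgroup_id_def intro!: map_idI)
  then show ?thesis
    by (auto simp: pgroup_hom_def pgroup_id_def)
qed

lemma pgroup_id_compose:
  assumes "\<phi> \<in> pgroup_hom M N"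
  shows "compose (carrier M) (pgroup_id N) \<phi> = \<phi>" and "compose (carrier M) \<phi> (pgroup_id M) = \<phi>"
  using assms by (auto simp: pgroup_hom_def pgroup_id_def compose_def fun_eq_iff PiE_def
      extensional_def Pi_def)

lemma pgroup_compose_assoc:
  assumes "\<phi> \<in> pgroup_hom M N"
  shows "compose (carrier M) \<theta> (compose (carrier M) \<psi> \<phi>) =
    compose (carrier M) (compose (carrier N) \<theta> \<psi>) \<phi>"
  using assms by (auto simp: pgroup_hom_def compose_def fun_eq_iff)

lemma group_pgroup_Aut:
  assumes M: "partial_group M"
  shows "group (pgroup_Aut M)"
proof (rule groupI)
  fix x y
  assume "x \<in> carrier (pgroup_Aut M)" "y \<in> carrier (pgroup_Aut M)"
  then obtain x' y' where h: "x \<in> pgroup_hom M M" "y \<in> pgroup_hom M M"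
      "x' \<in> pgroup_hom M M" "y' \<in> pgroup_hom M M"
    and inv: "compose (carrier M) x' x = pgroup_id M" "compose (carrier M) x x' = pgroup_id M"
      "compose (carrier M) y' y = pgroup_id M" "compose (carrier M) y y' = pgroup_id M"
    by (auto simp: pgroup_Aut_def pgroup_auts_def)
  let ?c = "compose (carrier M)"
  have "?c (?c y' x') (?c x y) = ?c y' (?c (?c x' x) y)"
    using h pgroup_compose_assoc pgroup_hom_compose[OF M] by metis
  then have 1: "?c (?c y' x') (?c x y) = pgroup_id M"
    using h inv by (simp add: pgroup_id_compose)
  have "?c (?c x y) (?c y' x') = ?c x (?c (?c y y') x')"
    using h pgroup_compose_assoc pgroup_hom_compose[OF M] by metis
  then have 2: "?c (?c x y) (?c y' x') = pgroup_id M"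
    using h inv by (simp add: pgroup_id_compose)
  show "x \<otimes>\<^bsub>pgroup_Aut M\<^esub> y \<in> carrier (pgroup_Aut M)"
    using 1 2 h pgroup_hom_compose[OF M] by (auto simp: pgroup_Aut_def pgroup_auts_def)
next
  show "\<one>\<^bsub>pgroup_Aut M\<^esub> \<in> carrier (pgroup_Aut M)"
    using pgroup_id_hom[OF M] pgroup_id_compose[OF pgroup_id_hom[OF M]]
    by (auto simp: pgroup_Aut_def pgroup_auts_def)
next
  fix x assume "x \<in> carrier (pgroup_Aut M)"
  then show "\<exists>y \<in> carrier (pgroup_Aut M). y \<otimes>\<^bsub>pgroup_Aut M\<^esub> x = \<one>\<^bsub>pgroup_Aut M\<^esub>"
    by (auto simp: pgroup_Aut_def pgroup_auts_def)
qed (auto simp: pgroup_Aut_def pgroup_auts_def pgroup_id_compose pgroup_compose_assoc)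

end

theory Submission
  imports Defs "HOL-Library.Z2" "HOL-Library.Function_Algebras" "HOL-Library.Product_Plus"
    "HOL-Combinatorics.Permutations"
begin

text \<open>
  Cutting a symmetric subset \<open>S\<close> containing the unit out of a group, and allowing exactly those
  words all of whose contiguous factors have their product in \<open>S\<close>, always gives a partial group
  (\<open>partial_group_window\<close>). The advantage over groups is that \<open>S\<close> can be made large without gaining
  automorphisms: for \<open>n \<ge> 1\<close> the interval \<open>[-n, n]\<close> in \<open>\<int>\<close> has \<open>2 n + 1\<close> elements, but its only
  automorphisms are \<open>\<plusminus>1\<close>, because \<open>(1, \<dots>, 1)\<close> with \<open>n\<close> letters is a word, so that an automorphism
  sends \<open>n\<close> to \<open>n\<close> times the image \<open>m\<close> of \<open>1\<close>, and \<open>\<bar>n m\<bar> \<le> n\<close> forces \<open>m = \<plusminus>1\<close>.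

  Adjoin to this interval \<open>k\<close> involutions: take \<open>S = [-n, n] \<union> {e\<^sub>1, \<dots>, e\<^sub>k}\<close> inside
  \<open>\<int> \<times> (\<int>/2)\<^sup>\<nat>\<close>, where the \<open>e\<^sub>i\<close> are unit vectors. The \<open>e\<^sub>i\<close> are the elements other than the unit
  that equal their own inverse, so an automorphism preserves both parts. Conversely a sign on \<open>\<int>\<close> and
  a permutation of the coordinates of \<open>(\<int>/2)\<^sup>\<nat>\<close> that moves only those belonging to the \<open>e\<^sub>i\<close> come
  from an endomorphism of the ambient group, hence give an automorphism
  (\<open>hom_of_additive\<close>). This yields \<open>2 \<cdot> k!\<close> automorphisms (\<open>order_Aut_window\<close>) on \<open>2 n + 1 + k\<close>
  elements.

  For \<open>r = a / b\<close> choose an odd \<open>k\<close> so large that \<open>a\<close> divides \<open>k!\<close> and \<open>k!/a\<close> exceeds \<open>k\<close>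
  comfortably. Then \<open>2 b k!/a\<close> is even and larger than \<open>k + 1\<close>, so it has the form \<open>2 n + 1 + k\<close> with
  \<open>n \<ge> 1\<close>, and \<open>2 k! / (2 b k!/a) = a / b\<close>.
\<close>

section \<open>Partial groups cut out of a group\<close>

text \<open>
  The subset of the group is presented as the image of an injective labelling \<open>f\<close> of \<open>A\<close>, so that
  the elements of the partial group may have any type, such as \<open>nat\<close>, independent of the group. The
  condition is imposed on all factors, not just on the whole word: this is what makes the set of
  words closed under factors and under contracting a factor to its product.
\<close>
definition group_window :: "('a \<Rightarrow> 'g::group_add) \<Rightarrow> 'a set \<Rightarrow> 'a pgroup" where
  "group_window f A =
     \<lparr>carrier = A,
      words = {u \<in> lists A. \<forall>p v s. u = p @ v @ s \<longrightarrow> sum_list (map f v) \<in> f ` A},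
      product = (\<lambda>u. inv_into A f (sum_list (map f u))),
      pinv = (\<lambda>x. inv_into A f (- f x))\<rparr>"

locale symmetric_labelling =
  fixes f :: "'a \<Rightarrow> 'g::group_add" and A :: "'a set"
  assumes inj: "inj_on f A"
    and zero: "0 \<in> f ` A"
    and uminus: "x \<in> A \<Longrightarrow> - f x \<in> f ` A"
begin

abbreviation "M \<equiv> group_window f A"

lemma carrier_window [simp]: "carrier M = A"
  by (simp add: group_window_def)

lemma words_iff:
  "u \<in> words M \<longleftrightarrow> u \<in> lists A \<and> (\<forall>p v s. u = p @ v @ s \<longrightarrow> sum_list (map f v) \<in> f ` A)"
  by (simp add: group_window_def)

lemma words_factor: "p @ v @ s \<in> words M \<Longrightarrow> sum_list (map f v) \<in> f ` A"
  unfolding words_iff by blast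

lemma factor_in_words:
  assumes "p @ v @ s \<in> words M"
  shows "v \<in> words M"
  unfolding words_iff
proof (intro conjI allI impI)
  show "v \<in> lists A" using assms by (simp add: words_iff)
  fix p' x s' assume "v = p' @ x @ s'"
  then show "sum_list (map f x) \<in> f ` A"
    using assms words_factor[of "p @ p'" x "s' @ s"] by simp
qed

lemma label_product:
  assumes "u \<in> words M"
  shows "product M u \<in> A" and "f (product M u) = sum_list (map f u)"
proof -
  have "sum_list (map f u) \<in> f ` A"
    using assms words_factor[of "[]" u "[]"] by simp
  then show "product M u \<in> A" "f (product M u) = sum_list (map f u)"
    by (auto simp: group_window_def inv_into_into f_inv_into_f)
qed

lemma product_cong: "sum_list (map f u) = sum_list (map f v) \<Longrightarrow> product M u = product M v"
  by (simp add: group_window_def)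

lemma pinv_window:
  assumes "x \<in> A"
  shows "pinv M x \<in> A" and "f (pinv M x) = - f x"
  using uminus[OF assms] by (auto simp: group_window_def inv_into_into f_inv_into_f)

lemma word_inv_lists: "u \<in> lists A \<Longrightarrow> word_inv M u \<in> lists A"
  by (auto simp: word_inv_def pinv_window)

lemma sum_word_inv:
  "u \<in> lists A \<Longrightarrow> sum_list (map f (word_inv M u)) = - sum_list (map f u)"
  by (induction u) (auto simp: word_inv_def pinv_window minus_add)

lemma word_inv_word_inv: "u \<in> lists A \<Longrightarrow> word_inv M (word_inv M u) = u"
proof -
  have "pinv M (pinv M x) = x" if "x \<in> A" for x
    using that inj by (metis inj_onD minus_minus pinv_window)
  then show "u \<in> lists A \<Longrightarrow> word_inv M (word_inv M u) = u"
    by (auto simp: word_inv_def rev_map[symmetric] intro!: map_idI)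
qed

lemma word_inv_append: "word_inv M (u @ v) = word_inv M v @ word_inv M u"
  by (simp add: word_inv_def)

text \<open>
  The factors of \<open>u\<^sup>-\<^sup>1 u\<close> are those of \<open>u\<close>, inverses of those, and the factors \<open>q\<^sup>-\<^sup>1 v\<close> straddling the
  middle, where \<open>q\<close> and \<open>v\<close> are prefixes of \<open>u\<close>. One of these two prefixes extends the other, so
  after cancellation only a factor of \<open>u\<close> or its inverse remains.
\<close>
lemma word_inv_in_words:
  assumes u: "u \<in> words M"
  shows "word_inv M u @ u \<in> words M"
  unfolding words_iff
proof (intro conjI allI impI)
  have uA: "u \<in> lists A" using u by (simp add: words_iff)
  then show "word_inv M u @ u \<in> lists A" by (simp add: word_inv_lists)
  have factor_inv: "sum_list (map f v) \<in> f ` A" if "word_inv M u = p @ v @ s" for p v s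
  proof -
    have vA: "v \<in> lists A" using word_inv_lists[OF uA] that by simp
    have "u = word_inv M s @ word_inv M v @ word_inv M p"
      using word_inv_word_inv[OF uA] that by (simp add: word_inv_append)
    then have "- sum_list (map f v) \<in> f ` A"
      using u words_factor sum_word_inv[OF vA] by metis
    then show ?thesis using uminus by (metis imageE minus_minus)
  qed
  fix p v s assume eq: "word_inv M u @ u = p @ v @ s"
  then consider
      (left) s' where "word_inv M u = p @ v @ s'"
    | (right) p' where "u = p' @ v @ s"
    | (straddle) v1 v2 where "v = v1 @ v2" "word_inv M u = p @ v1" "u = v2 @ s"
    by (auto simp: append_eq_append_conv2)
  then show "sum_list (map f v) \<in> f ` A"
  proof cases
    case left
    then show ?thesis by (rule factor_inv)
  next
    case right
    then show ?thesis using u words_factor by blast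
  next
    case straddle
    have v1A: "v1 \<in> lists A" using word_inv_lists[OF uA] straddle by simp
    define q where "q = word_inv M v1"
    have qA: "q \<in> lists A" and v1: "v1 = word_inv M q"
      using v1A by (simp_all add: q_def word_inv_lists word_inv_word_inv)
    have "u = word_inv M (p @ v1)"
      using word_inv_word_inv[OF uA] straddle(2) by simp
    then have uq: "u = q @ word_inv M p"
      by (simp add: q_def word_inv_append)
    have sum: "sum_list (map f v) = - sum_list (map f q) + sum_list (map f v2)"
      using straddle(1) v1 sum_word_inv[OF qA] by simp
    from uq straddle(3) consider r where "q = v2 @ r" | r where "v2 = q @ r"
      by (auto simp: append_eq_append_conv2)
    then show ?thesis
    proof cases
      case 1
      then have "sum_list (map f r) \<in> f ` A"
        using uq u words_factor[of v2 r "word_inv M p"] by simp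
      moreover have "sum_list (map f v) = - sum_list (map f r)"
        using sum 1 by (simp add: minus_add)
      ultimately show ?thesis using uminus by auto
    next
      case 2
      then have "sum_list (map f r) \<in> f ` A"
        using straddle(3) u words_factor[of q r s] by simp
      moreover have "sum_list (map f v) = sum_list (map f r)"
        using sum 2 by (simp add: add.assoc[symmetric])
      ultimately show ?thesis by simp
    qed
  qed
qed

text \<open>
  A factor of the contracted word that contains the new letter has the same sum as the factor of
  \<open>u @ v @ w\<close> obtained by expanding that letter again.
\<close>
lemma contract_in_words:
  assumes uvw: "u @ v @ w \<in> words M"
  shows "u @ [product M v] @ w \<in> words M"
  unfolding words_iff
proof (intro conjI allI impI)
  have v: "v \<in> words M"
    using uvw by (rule factor_in_words)
  then show "u @ [product M v] @ w \<in> lists A"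
    using uvw label_product(1) by (auto simp: words_iff)
  fix p x s assume "u @ [product M v] @ w = p @ x @ s"
  then consider
      (left) s' where "u = p @ x @ s'"
    | (right) p' where "w = p' @ x @ s"
    | (over) x1 x2 where "x = x1 @ [product M v] @ x2" "u = p @ x1" "w = x2 @ s"
    by (auto simp: append_eq_append_conv2 Cons_eq_append_conv append_eq_Cons_conv)
  then show "sum_list (map f x) \<in> f ` A"
  proof cases
    case left
    then show ?thesis using uvw words_factor[of p x "s' @ v @ w"] by simp
  next
    case right
    then show ?thesis using uvw words_factor[of "u @ v @ p'" x s] by simp
  next
    case over
    then have "sum_list (map f x) = sum_list (map f (x1 @ v @ x2))"
      using label_product(2)[OF v] by (simp add: add.assoc)
    moreover have "p @ (x1 @ v @ x2) @ s \<in> words M"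
      using uvw over by simp
    ultimately show ?thesis using words_factor by metis
  qed
qed

theorem partial_group_window: "partial_group M"
proof
  show "words M \<subseteq> lists (carrier M)" by (auto simp: words_iff)
  show "product M \<in> words M \<rightarrow> carrier M" by (simp add: label_product(1))
  show "pinv M \<in> carrier M \<rightarrow> carrier M" by (simp add: pinv_window)
  show "pinv M (pinv M x) = x" if "x \<in> carrier M" for x
    using word_inv_word_inv[of "[x]"] that by (simp add: word_inv_def)
  show "[x] \<in> words M" if "x \<in> carrier M" for x
    using that zero by (auto simp: words_iff Cons_eq_append_conv)
  show "u \<in> words M \<and> v \<in> words M" if "u @ v \<in> words M" for u v
    using that factor_in_words[of "[]" u v] factor_in_words[of u v "[]"] by simp
  show "[] \<in> words M" using zero by (simp add: words_iff)
  show "product M [x] = x" if "x \<in> carrier M" for x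
    using that inj by (simp add: group_window_def)
  show "u @ [product M v] @ w \<in> words M \<and>
      product M (u @ v @ w) = product M (u @ [product M v] @ w)"
    if "u @ v @ w \<in> words M" for u v w
  proof -
    have "v \<in> words M" using that by (rule factor_in_words)
    then show ?thesis
      using that contract_in_words by (auto intro!: product_cong simp: label_product(2))
  qed
  show "word_inv M u @ u \<in> words M \<and> product M (word_inv M u @ u) = product M []"
    if "u \<in> words M" for u
    using that word_inv_in_words
    by (intro conjI product_cong) (simp_all add: sum_word_inv words_iff[of u])
qed

text \<open>
  An endomorphism of the group that maps the window into itself is a morphism of partial groups,
  since it maps the sum of each factor to the sum of the image of that factor.
\<close>
lemma hom_of_additive:
  assumes \<phi>: "\<phi> \<in> A \<rightarrow>\<^sub>E A"
    and h: "\<And>a b. h (a + b) = h a + h b"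
    and f\<phi>: "\<And>x. x \<in> A \<Longrightarrow> f (\<phi> x) = h (f x)"
  shows "\<phi> \<in> pgroup_hom M M"
proof -
  have h0: "h 0 = 0" using h[of 0 0] by (metis add.right_neutral add_left_cancel)
  have sum: "sum_list (map f (map \<phi> u)) = h (sum_list (map f u))" if "u \<in> lists A" for u
    using that by (induction u) (auto simp: h h0 f\<phi>)
  have "map \<phi> u \<in> words M \<and> product M (map \<phi> u) = \<phi> (product M u)" if u: "u \<in> words M" for u
  proof
    have uA: "u \<in> lists A" using u by (simp add: words_iff)
    show mu: "map \<phi> u \<in> words M"
      unfolding words_iff
    proof (intro conjI allI impI)
      show "map \<phi> u \<in> lists A" using uA PiE_mem[OF \<phi>] by auto
      fix p v s assume "map \<phi> u = p @ v @ s"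
      then obtain p' v' s' where u': "u = p' @ v' @ s'" and v: "v = map \<phi> v'"
        by (auto simp: map_eq_append_conv append_eq_map_conv)
      then have "sum_list (map f v') \<in> f ` A" using u words_factor by blast
      then obtain x where "x \<in> A" "sum_list (map f v') = f x" by auto
      moreover have "v' \<in> lists A" using u' uA by simp
      ultimately have "sum_list (map f v) = f (\<phi> x)" by (simp only: v sum f\<phi>)
      then show "sum_list (map f v) \<in> f ` A" using \<open>x \<in> A\<close> \<phi> by auto
    qed
    have "f (product M (map \<phi> u)) = f (\<phi> (product M u))"
      using label_product[OF u] by (simp only: label_product(2)[OF mu] sum[OF uA] f\<phi>)
    then show "product M (map \<phi> u) = \<phi> (product M u)"
      using inj label_product(1)[OF u] label_product(1)[OF mu] \<phi> by (auto dest: inj_onD)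
  qed
  then show ?thesis using \<phi> by (simp add: pgroup_hom_def)
qed

text \<open>
  The form in which a morphism is evaluated below: a known factorisation of \<open>x\<close> as an admissible
  word determines the label of \<open>\<phi> x\<close>.
\<close>
lemma label_hom_product:
  assumes \<phi>: "\<phi> \<in> pgroup_hom M M" and u: "u \<in> words M"
    and x: "x \<in> A" "f x = sum_list (map f u)"
  shows "f (\<phi> x) = sum_list (map f (map \<phi> u))"
proof -
  have "x = product M u"
    using x inv_into_f_f[OF inj x(1)] by (simp add: group_window_def)
  then show ?thesis
    using \<phi> u label_product(2) by (metis (mono_tags, lifting) mem_Collect_eq pgroup_hom_def)
qed

end

section \<open>An interval of integers together with involutions\<close>

text \<open>
  The index \<open>i \<le> 2 n\<close> stands for the integer \<open>i - n\<close>, so \<open>n\<close> is the unit and \<open>2 n - i\<close> the inverse of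
  \<open>i\<close>; each index beyond \<open>2 n\<close> stands for a unit vector of \<open>(\<int>/2)\<^sup>\<nat>\<close>. The unit vectors are numbered
  by the index itself, so a permutation of the indices acts on the ambient group simply by permuting
  coordinates.
\<close>
definition label :: "nat \<Rightarrow> nat \<Rightarrow> int \<times> (nat \<Rightarrow> bit)" where
  "label n i = (if i \<le> 2 * n then (int i - int n, 0) else (0, \<lambda>j. if j = i then 1 else 0))"

definition sym_aut :: "nat \<Rightarrow> nat \<Rightarrow> bool \<Rightarrow> (nat \<Rightarrow> nat) \<Rightarrow> nat \<Rightarrow> nat" where
  "sym_aut n k b \<pi> =
     (\<lambda>i\<in>{..2 * n + k}. if i \<le> 2 * n then if b then 2 * n - i else i else \<pi> i)"

lemma inj_label: "inj (label n)"
proof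
  fix i j assume "label n i = label n j"
  then show "i = j"
    by (auto simp: label_def fun_eq_iff zero_fun_def split: if_splits)
qed

lemma label_eq_iff [simp]: "label n i = label n j \<longleftrightarrow> i = j"
  using inj_label by (rule inj_eq)

lemma label_uminus: "- label n i = label n (if i \<le> 2 * n then 2 * n - i else i)"
  by (auto simp: label_def fun_eq_iff)

lemma label_middle: "label n n = 0"
  by (simp add: label_def zero_prod_def)

interpretation window: symmetric_labelling "label n" "{..2 * n + k}" for n k
proof
  show "inj_on (label n) {..2 * n + k}" using inj_label by (rule inj_on_subset) simp
  show "0 \<in> label n ` {..2 * n + k}" using label_middle[of n] by (auto intro!: image_eqI[of _ _ n])
  show "- label n i \<in> label n ` {..2 * n + k}" if "i \<in> {..2 * n + k}" for i
    using that by (auto simp: label_uminus)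
qed

lemma permutes_tail_iff:
  fixes n k :: nat
  assumes "\<pi> permutes {2 * n<..2 * n + k}"
  shows "\<pi> i \<le> 2 * n \<longleftrightarrow> i \<le> 2 * n" and "\<pi> i \<le> 2 * n + k \<longleftrightarrow> i \<le> 2 * n + k"
proof -
  have "\<pi> i \<in> {2 * n<..2 * n + k} \<longleftrightarrow> i \<in> {2 * n<..2 * n + k}"
    using assms by (rule permutes_in_image)
  moreover have "i \<notin> {2 * n<..2 * n + k} \<Longrightarrow> \<pi> i = i"
    using assms by (rule permutes_not_in)
  ultimately show "\<pi> i \<le> 2 * n \<longleftrightarrow> i \<le> 2 * n" and "\<pi> i \<le> 2 * n + k \<longleftrightarrow> i \<le> 2 * n + k"
    by auto
qed

lemma sym_aut_hom:
  assumes \<pi>: "\<pi> permutes {2 * n<..2 * n + k}"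
  shows "sym_aut n k b \<pi> \<in> pgroup_hom (window.M n k) (window.M n k)"
proof (rule window.hom_of_additive)
  \<comment> \<open>The coordinates are permuted by the inverse of \<open>\<pi>\<close>, so that the unit vector at \<open>i\<close> goes to the one at \<open>\<pi> i\<close>.\<close>
  let ?h = "\<lambda>(z, w). (if b then - z else z :: int, \<lambda>j. w (inv_into UNIV \<pi> j) :: bit)"
  show "?h (x + y) = ?h x + ?h y" for x y
    by (cases x; cases y) (auto simp: plus_fun_def)
  show "sym_aut n k b \<pi> \<in> {..2 * n + k} \<rightarrow>\<^sub>E {..2 * n + k}"
    by (auto simp: sym_aut_def permutes_tail_iff[OF \<pi>])
  show "label n (sym_aut n k b \<pi> i) = ?h (label n i)" if "i \<in> {..2 * n + k}" for i
  proof (cases "i \<le> 2 * n")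
    case True
    then show ?thesis using that by (auto simp: sym_aut_def label_def fun_eq_iff)
  next
    case False
    moreover have "j = \<pi> i \<longleftrightarrow> inv_into UNIV \<pi> j = i" for j
      using permutes_inv_eq[OF \<pi>, of j i] by auto
    ultimately show ?thesis
      using that by (simp add: sym_aut_def label_def permutes_tail_iff(1)[OF \<pi>])
  qed
qed

lemma sym_aut_inverse:
  assumes \<pi>: "\<pi> permutes {2 * n<..2 * n + k}"
  shows "compose {..2 * n + k} (sym_aut n k b (inv_into UNIV \<pi>)) (sym_aut n k b \<pi>) =
    (\<lambda>i\<in>{..2 * n + k}. i)"
  by (auto simp: sym_aut_def compose_def fun_eq_iff permutes_tail_iff[OF \<pi>]
      permutes_inverses[OF \<pi>])

lemma sym_aut_in_auts:
  assumes \<pi>: "\<pi> permutes {2 * n<..2 * n + k}"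
  shows "sym_aut n k b \<pi> \<in> pgroup_auts (window.M n k)"
proof -
  have inv: "inv_into UNIV \<pi> permutes {2 * n<..2 * n + k}" "inv_into UNIV (inv_into UNIV \<pi>) = \<pi>"
    using \<pi> by (simp_all add: permutes_inv permutes_inv_inv)
  show ?thesis
    unfolding pgroup_auts_def pgroup_id_def window.carrier_window
    using sym_aut_hom[OF \<pi>] sym_aut_hom[OF inv(1)] sym_aut_inverse[OF \<pi>]
      sym_aut_inverse[OF inv(1), unfolded inv(2)]
    by blast
qed

lemma inj_on_auts:
  assumes "\<phi> \<in> pgroup_auts M"
  shows "inj_on \<phi> (carrier M)"
proof -
  obtain \<psi> where "compose (carrier M) \<psi> \<phi> = pgroup_id M"
    using assms by (auto simp: pgroup_auts_def)
  then have "\<psi> (\<phi> x) = x" if "x \<in> carrier M" for x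
    using that by (metis compose_eq pgroup_id_def restrict_apply')
  then show ?thesis by (rule inj_on_inverseI)
qed

text \<open>
  The steps are those of the introduction: an automorphism fixes the unit and commutes with inverses,
  so it preserves the set of involutions and its complement, the interval, where it is multiplication
  by the image \<open>m\<close> of \<open>1\<close>.
\<close>
lemma aut_is_sym_aut:
  assumes n: "1 \<le> n" and \<phi>: "\<phi> \<in> pgroup_auts (window.M n k)"
  shows "\<exists>b \<pi>. \<pi> permutes {2 * n<..2 * n + k} \<and> \<phi> = sym_aut n k b \<pi>"
proof -
  let ?A = "{..2 * n + k}" and ?T = "{2 * n<..2 * n + k}" and ?M = "window.M n k"
  have hom: "\<phi> \<in> pgroup_hom ?M ?M" using \<phi> by (simp add: pgroup_auts_def)
  then have ext: "\<phi> \<in> ?A \<rightarrow>\<^sub>E ?A" by (simp add: pgroup_hom_def)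
  have closed: "\<phi> i \<in> ?A" if "i \<in> ?A" for i using ext that by (rule PiE_mem)
  have inj: "inj_on \<phi> ?A" using inj_on_auts[OF \<phi>] by simp
  have "label n (\<phi> n) = 0"
    using window.label_hom_product[OF hom, of "[]" n]
      partial_group.Nil_in_words[OF window.partial_group_window[of n k]]
    by (simp add: label_middle)
  then have \<phi>n: "\<phi> n = n" by (metis label_eq_iff label_middle)
  have uminus_word: "word_inv ?M [i] @ [i] \<in> words ?M" if "i \<in> ?A" for i
    using that window.word_inv_in_words[of "[i]" n k]
      partial_group.D1[OF window.partial_group_window[of n k], of i] by simp
  have pinv: "pinv ?M i = (if i \<le> 2 * n then 2 * n - i else i)" if "i \<in> ?A" for i
    using window.pinv_window(2)[of i n k] that by (simp add: label_uminus)
  \<comment> \<open>Apply \<open>\<phi>\<close> to the word formed by the inverse of \<open>i\<close> and \<open>i\<close>, whose product is the unit.\<close>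
  have \<phi>_uminus: "\<phi> (pinv ?M i) = pinv ?M (\<phi> i)" if i: "i \<in> ?A" for i
  proof -
    have "label n (\<phi> n) = sum_list (map (label n) (map \<phi> (word_inv ?M [i] @ [i])))"
      using window.pinv_window(2)[of i n k] i
      by (intro window.label_hom_product[OF hom uminus_word]) (auto simp: word_inv_def label_middle)
    then have "label n (\<phi> (pinv ?M i)) + label n (\<phi> i) = 0"
      by (simp add: \<phi>n label_middle word_inv_def)
    then have "label n (\<phi> (pinv ?M i)) = - label n (\<phi> i)"
      by (simp add: eq_neg_iff_add_eq_0)
    also have "\<dots> = label n (pinv ?M (\<phi> i))"
      using window.pinv_window(2)[OF closed[OF i]] by simp
    finally show ?thesis by simp
  qed
  have fixed_iff: "pinv ?M i = i \<longleftrightarrow> i = n \<or> i \<in> ?T" if "i \<in> ?A" for i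
    using that by (auto simp: pinv)
  have T: "\<phi> i \<in> ?T \<longleftrightarrow> i \<in> ?T" if i: "i \<in> ?A" for i
  proof -
    have "pinv ?M i = i \<longleftrightarrow> pinv ?M (\<phi> i) = \<phi> i"
      using \<phi>_uminus[OF i] inj_on_eq_iff[OF inj window.pinv_window(1)[OF i] i] by simp
    moreover have "\<phi> i = n \<longleftrightarrow> i = n" using inj_on_eq_iff[OF inj i, of n] \<phi>n by simp
    ultimately show ?thesis using fixed_iff[OF i] fixed_iff[OF closed[OF i]] by auto
  qed
  define \<pi> where "\<pi> i = (if i \<in> ?T then \<phi> i else i)" for i
  have \<pi>: "\<pi> permutes ?T"
  proof (rule bij_imp_permutes)
    have "inj_on \<phi> ?T" using inj by (rule inj_on_subset) auto
    moreover have "\<phi> ` ?T \<subseteq> ?T" using T by fastforce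
    ultimately have "bij_betw \<phi> ?T ?T" by (simp add: bij_betw_def endo_inj_surj)
    then show "bij_betw \<pi> ?T ?T" by (rule bij_betw_cong[THEN iffD1, rotated]) (simp add: \<pi>_def)
  qed (auto simp: \<pi>_def)
  define m where "m = int (\<phi> (n + 1)) - int n"
  have small: "\<phi> i \<le> 2 * n" if "i \<le> 2 * n" for i
    using T[of i] ext that by fastforce
  have sum_replicate: "sum_list (replicate j (z, 0)) = (int j * z, 0 :: nat \<Rightarrow> bit)" for j and z :: int
    by (induction j) (auto simp: zero_prod_def algebra_simps)
  have unit: "label n (n + 1) = (1, 0)" using n by (simp add: label_def)
  \<comment> \<open>The integer \<open>j\<close> is the product of the word \<open>(1, \<dots>, 1)\<close> of length \<open>j\<close>, whose factors have products in \<open>[0, n]\<close>.\<close>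
  have upper: "int (\<phi> (n + j)) - int n = int j * m" if j: "j \<le> n" for j
  proof -
    have "replicate j (n + 1) \<in> words ?M"
      unfolding window.words_iff
    proof (intro conjI allI impI)
      show "replicate j (n + 1) \<in> lists ?A" using n by (auto dest: in_set_replicate[THEN iffD1])
      fix p v s assume eq: "replicate j (n + 1) = p @ v @ s"
      then have "\<forall>x\<in>set v. x = n + 1"
        by (metis Un_iff in_set_replicate set_append)
      then have v: "v = replicate (length v) (n + 1)" by (simp add: replicate_eqI)
      have len: "length v \<le> n" using arg_cong[OF eq, of length] j by simp
      have "sum_list (map (label n) v) = label n (n + length v)"
        by (subst v) (use len in \<open>simp only: map_replicate unit sum_replicate, simp add: label_def\<close>)
      then show "sum_list (map (label n) v) \<in> label n ` ?A" using len by auto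
    qed
    then have "label n (\<phi> (n + j)) = sum_list (map (label n) (map \<phi> (replicate j (n + 1))))"
      using j by (intro window.label_hom_product[OF hom])
        (simp_all only: map_replicate unit sum_replicate, auto simp: label_def)
    moreover have "label n (\<phi> (n + 1)) = (m, 0)"
      using small[of "n + 1"] n by (simp add: label_def m_def)
    ultimately have "label n (\<phi> (n + j)) = (int j * m, 0)"
      by (simp only: map_replicate sum_replicate)
    then show ?thesis using small[of "n + j"] j by (simp add: label_def)
  qed
  have "m \<noteq> 0"
  proof
    assume "m = 0"
    then have "\<phi> (n + 1) = \<phi> n" by (simp add: m_def \<phi>n)
    then show False using inj n by (auto dest: inj_onD)
  qed
  moreover have "\<bar>int n * m\<bar> \<le> int n"
    using upper[of n] small[of "n + n"] by simp
  then have "\<bar>m\<bar> \<le> 1" using n by (simp add: abs_mult)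
  ultimately have m: "m = 1 \<or> m = - 1" by linarith
  \<comment> \<open>The negative integers are reached by inversion.\<close>
  have window_part: "\<phi> i = (if m = - 1 then 2 * n - i else i)" if i: "i \<le> 2 * n" for i
  proof (cases "n \<le> i")
    case True
    then have "int (\<phi> i) - int n = (int i - int n) * m"
      using upper[of "i - n"] i by (simp add: of_nat_diff)
    then show ?thesis using m i by auto
  next
    case False
    then have i': "i = pinv ?M (2 * n - i)" by (simp add: pinv)
    have "n + (n - i) = 2 * n - i" using False by simp
    then have "int (\<phi> (2 * n - i)) - int n = (int n - int i) * m"
      using upper[of "n - i"] False by (simp add: of_nat_diff)
    then have "\<phi> (2 * n - i) = (if m = - 1 then i else 2 * n - i)"
      using False m by auto
    then have "pinv ?M (\<phi> (2 * n - i)) = (if m = - 1 then 2 * n - i else i)"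
      using i by (simp add: pinv)
    then show ?thesis using \<phi>_uminus[of "2 * n - i"] i' by simp
  qed
  have "\<phi> = sym_aut n k (m = - 1) \<pi>"
  proof
    fix i show "\<phi> i = sym_aut n k (m = - 1) \<pi> i"
      using ext window_part[of i] by (auto simp: sym_aut_def \<pi>_def)
  qed
  then show ?thesis using \<pi> by blast
qed

lemma inj_on_sym_aut:
  assumes n: "1 \<le> n"
  shows "inj_on (\<lambda>(b, \<pi>). sym_aut n k b \<pi>) (UNIV \<times> {\<pi>. \<pi> permutes {2 * n<..2 * n + k}})"
proof (rule inj_onI, clarsimp)
  fix b c \<pi> \<rho>
  assume \<pi>: "\<pi> permutes {2 * n<..2 * n + k}" and \<rho>: "\<rho> permutes {2 * n<..2 * n + k}"
    and eq: "sym_aut n k b \<pi> = sym_aut n k c \<rho>"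
  have "b = c"
    using fun_cong[OF eq, of 0] n by (auto simp: sym_aut_def split: if_splits)
  moreover have "\<pi> i = \<rho> i" for i
  proof (cases "i \<in> {2 * n<..2 * n + k}")
    case True
    then show ?thesis using fun_cong[OF eq, of i] by (simp add: sym_aut_def)
  next
    case False
    then show ?thesis using \<pi> \<rho> by (metis permutes_not_in)
  qed
  ultimately show "b = c \<and> \<pi> = \<rho>" by auto
qed

lemma order_Aut_window:
  assumes "1 \<le> n"
  shows "order (pgroup_Aut (window.M n k)) = 2 * fact k"
proof -
  let ?P = "{\<pi>. \<pi> permutes {2 * n<..2 * n + k}}"
  have "pgroup_auts (window.M n k) = (\<lambda>(b, \<pi>). sym_aut n k b \<pi>) ` (UNIV \<times> ?P)"
    using aut_is_sym_aut[OF assms] sym_aut_in_auts by fastforce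
  then have "card (pgroup_auts (window.M n k)) = card ((UNIV :: bool set) \<times> ?P)"
    using card_image[OF inj_on_sym_aut[OF assms]] by simp
  also have "\<dots> = 2 * fact k"
    by (simp add: card_cartesian_product card_permutations)
  finally show ?thesis by (simp add: order_def pgroup_Aut_def)
qed

section \<open>Every positive rational number is attained\<close>

theorem theorem1p3:
  fixes r :: rat
  assumes "0 < r"
  shows "\<exists>M :: nat pgroup. partial_group M \<and> finite (carrier M) \<and>
    r = of_nat (order (pgroup_Aut M)) / of_nat (card (carrier M))"
proof -
  obtain a' b' :: int where r': "r = of_int a' / of_int b'" "0 < b'"
    by (cases r) (auto simp: Fract_of_int_quotient)
  then have "0 < a'" using assms by (simp add: zero_less_divide_iff)
  then obtain a b :: nat where r: "r = of_nat a / of_nat b" and a: "0 < a" and b: "0 < b"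
    using r' by (metis of_int_of_nat_eq zero_less_imp_eq_int)
  \<comment> \<open>An odd number for which \<open>(k - 1)!\<close> is a multiple of \<open>a\<close> and exceeds \<open>2 a\<close>, so that \<open>k! / a \<ge> 2 k\<close>.\<close>
  define k where "k = 2 * a + 3"
  have "a dvd fact (k - 1)" using a by (intro dvd_fact) (auto simp: k_def)
  then obtain q where q: "fact (k - 1) = a * q" by blast
  have fact_k: "fact k = k * (a * q)" using q by (simp add: fact_reduce k_def)
  have "k - 1 \<le> a * q" using fact_ge_self[of "k - 1"] by (simp only: q)
  have "2 < q"
  proof (rule ccontr)
    assume "\<not> 2 < q"
    then have "a * q \<le> a * 2" by (intro mult_le_mono2) simp
    with \<open>k - 1 \<le> a * q\<close> show False unfolding k_def by linarith
  qed
  then have kq: "2 * k \<le> b * k * q"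
    using b mult_le_mono[of 2 q k "b * k"] by (simp add: ac_simps)
  \<comment> \<open>The solution of \<open>2 n + 1 + k = 2 b k! / a\<close>, where \<open>(k + 1) / 2 = a + 2\<close>.\<close>
  define n where "n = b * k * q - (a + 2)"
  have n: "1 \<le> n" and size: "2 * n + k + 1 = 2 * (b * k * q)"
    using kq by (auto simp: n_def k_def)
  have "a * (2 * (b * k * q)) = 2 * fact k * b" by (simp add: fact_k)
  then have "(of_nat a :: rat) * of_nat (2 * (b * k * q)) = of_nat (2 * fact k) * of_nat b"
    by (metis of_nat_mult)
  moreover have "b * k * q \<noteq> 0" using b \<open>2 < q\<close> by (simp add: k_def)
  ultimately have "r = of_nat (2 * fact k) / of_nat (2 * (b * k * q))"
    using b unfolding r by (subst frac_eq_eq) (auto simp del: of_nat_mult)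
  then have "r = of_nat (order (pgroup_Aut (window.M n k))) / of_nat (card (carrier (window.M n k)))"
    using size by (simp only: order_Aut_window[OF n] window.carrier_window card_atMost) simp
  then show ?thesis
    using window.partial_group_window[of n k] by (intro exI[of _ "window.M n k"]) simp
qed

end
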